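(* The finitely presented, torsion-free partially ordered abelian groups are, up to isomorphism (of partially ordered abelian groups), exactly those of the form $\langle\mathbb{Z}^n,+,0,P\rangle$, that is, the group $\mathbb{Z}^n$ with positive cone $P$, where $n$ is a non-negative integer and $P$ is a finitely generated submonoid of $(\mathbb{Z}^+)^n$.
   Context: A partially ordered abelian group is an abelian group $G$ with a partial ordering $\leq$ such that $x\leq y$ implies $x+z\leq y+z$ for all $x,y,z\in G$; its positive cone is $G^+=\{x\in G\mid x\geq 0\}$. The notation $\langle G,+,0,P\rangle$ means the abelian group $G$ ordered by $x\leq y\iff y-x\in P$. $G$ is finitely presented if there exists a finite generating subset $\{g_1,\ldots,g_n\}$ of the group $G$ such that $\{\langle x_1,\ldots,x_n\rangle\in\mathbb{Z}^n\mid g_1x_1+\cdots+g_nx_n\geq 0\}$ is a finitely generated submonoid of $\mathbb{Z}^n$. $\mathbb{Z}^+$ is the set of non-negative integers. *)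

theory Defs
  imports "HOL-Algebra.FiniteProduct" "HOL-Algebra.Generated_Groups" "HOL-Algebra.Product_Groups"
begin

text \<open>
  As everywhere in HOL-Algebra, groups are written multiplicatively, so \<open>g\<^sub>1x\<^sub>1 + \<dots> + g\<^sub>nx\<^sub>n\<close> appears
  below as a finite product of integer powers and \<open>0\<close> as \<open>\<one>\<close>. The order \<open>leq\<close> is only
  meaningful on the carrier.
\<close>

record 'a ordered_monoid = "'a monoid" +
  leq :: "'a \<Rightarrow> 'a \<Rightarrow> bool" (infixl \<open>\<preceq>\<index>\<close> 50)

locale po_comm_group = comm_group G for G (structure) +
  assumes leq_refl: "reflp_on (carrier G) (leq G)"
    and leq_antisym: "antisymp_on (carrier G) (leq G)"
    and leq_trans: "transp_on (carrier G) (leq G)"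
    and leq_mult_right:
      "\<lbrakk>x \<in> carrier G; y \<in> carrier G; z \<in> carrier G; x \<preceq> y\<rbrakk> \<Longrightarrow> x \<otimes> z \<preceq> y \<otimes> z"

definition po_group_iso ::
    "('a, 'c) ordered_monoid_scheme \<Rightarrow> ('b, 'd) ordered_monoid_scheme \<Rightarrow> ('a \<Rightarrow> 'b) set" where
  "po_group_iso G H =
     {h \<in> Group.iso G H. \<forall>x\<in>carrier G. \<forall>y\<in>carrier G. x \<preceq>\<^bsub>G\<^esub> y \<longleftrightarrow> h x \<preceq>\<^bsub>H\<^esub> h y}"

definition po_group_isomorphic ::
    "('a, 'c) ordered_monoid_scheme \<Rightarrow> ('b, 'd) ordered_monoid_scheme \<Rightarrow> bool" where
  "po_group_isomorphic G H \<longleftrightarrow> po_group_iso G H \<noteq> {}"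

definition torsion_free :: "('a, 'c) monoid_scheme \<Rightarrow> bool" where
  "torsion_free G \<longleftrightarrow>
     (\<forall>x\<in>carrier G. \<forall>k::nat. k > 0 \<longrightarrow> x [^]\<^bsub>G\<^esub> k = \<one>\<^bsub>G\<^esub> \<longrightarrow> x = \<one>\<^bsub>G\<^esub>)"

definition generated_submonoid :: "('a, 'c) monoid_scheme \<Rightarrow> 'a set \<Rightarrow> 'a set" where
  "generated_submonoid M S = \<Inter>{N. submonoid N M \<and> S \<subseteq> N}"

definition fg_submonoid :: "'a set \<Rightarrow> ('a, 'c) monoid_scheme \<Rightarrow> bool" where
  "fg_submonoid P M \<longleftrightarrow>
     submonoid P M \<and> (\<exists>S. finite S \<and> S \<subseteq> carrier M \<and> P = generated_submonoid M S)"

text \<open>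
  \<open>\<int>\<^sup>n\<close> and \<open>(\<int>\<^sup>+)\<^sup>n\<close>: the vectors are the functions on \<open>{..<n}\<close>, extended by \<open>undefined\<close>
  outside (\<open>extensional\<close>), so that equality of vectors is equality of functions.
\<close>

definition Zn :: "nat \<Rightarrow> (nat \<Rightarrow> int) monoid" where
  "Zn n = product_group {..<n} (\<lambda>_. integer_group)"

definition nonneg_vectors :: "nat \<Rightarrow> (nat \<Rightarrow> int) set" where
  "nonneg_vectors n = ({..<n} \<rightarrow>\<^sub>E {0..})"

definition finitely_presented :: "('a, 'c) ordered_monoid_scheme \<Rightarrow> bool" where
  "finitely_presented G \<longleftrightarrow>
     (\<exists>n (g :: nat \<Rightarrow> 'a).
        inj_on g {..<n} \<and> g ` {..<n} \<subseteq> carrier G \<and>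
        generate G (g ` {..<n}) = carrier G \<and>
        fg_submonoid
          {x \<in> carrier (Zn n). \<one>\<^bsub>G\<^esub> \<preceq>\<^bsub>G\<^esub> (\<Otimes>\<^bsub>G\<^esub>i\<in>{..<n}. g i [^]\<^bsub>G\<^esub> x i)} (Zn n))"

text \<open>The group \<open>G\<close> ordered by \<open>x \<le> y \<longleftrightarrow> y - x \<in> P\<close>.\<close>

definition ordered_by :: "('a, 'c) monoid_scheme \<Rightarrow> 'a set \<Rightarrow> 'a ordered_monoid" where
  "ordered_by G P =
     \<lparr>carrier = carrier G, monoid.mult = monoid.mult G, one = \<one>\<^bsub>G\<^esub>,
      leq = (\<lambda>x y. y \<otimes>\<^bsub>G\<^esub> inv\<^bsub>G\<^esub> x \<in> P)\<rparr>"

end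

theory Submission
  imports Defs Complex_Main
begin

text \<open>
  Given a surjection \<open>\<int>\<^sup>n \<rightarrow> G\<close> with a nontrivial relation, Euclid's algorithm on the entries of the
  relation, carried out by automorphisms \<open>x\<^sub>i \<leftarrow> x\<^sub>i + s x\<^sub>j\<close> of \<open>\<int>\<^sup>n\<close>, turns it into a multiple of a
  generator; as \<open>G\<close> is torsion-free, this generator is trivial and can be dropped. Hence \<open>G \<cong> \<int>\<^sup>n\<close>, with
  a finitely generated positive cone that contains no nontrivial pair of inverses. Such a cone has an
  integral functional that is positive on its nonzero generators. The same Euclidean algorithm, applied
  to the coefficients of the functional, makes it a multiple of a single coordinate, and adding a large
  multiple of that coordinate to all others moves the cone into the nonnegative orthant.
\<close>

subsection \<open>Integer vectors\<close>

text \<open>Euclid's algorithm as an induction rule: while two entries of index at most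
  \<open>n\<close> are nonzero, a suitable step lowers the sum of absolute values; in the end all
  weight up to index \<open>n\<close> sits at index \<open>n\<close>.\<close>

lemma transvection_induct [case_names transvect supported]:
  fixes c :: "nat \<Rightarrow> int"
  assumes transvect: "\<And>c i j s. \<lbrakk>i \<le> n; j \<le> n; i \<noteq> j; Q (c(i := c i + s * c j))\<rbrakk> \<Longrightarrow> Q c"
    and supported: "\<And>c. (\<forall>i<n. c i = 0) \<Longrightarrow> Q c"
  shows "Q c"
proof (induction "\<Sum>i\<le>n. nat \<bar>c i\<bar>" arbitrary: c rule: less_induct)
  case less
  show ?case
  proof (cases "\<exists>i\<le>n. \<exists>j\<le>n. i \<noteq> j \<and> c i \<noteq> 0 \<and> c j \<noteq> 0")
    case True
    then obtain i j where ij: "i \<le> n" "j \<le> n" "i \<noteq> j" "c j \<noteq> 0" "\<bar>c j\<bar> \<le> \<bar>c i\<bar>"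
      by (metis linorder_le_cases)
    \<comment> \<open>With this sign \<open>s * c j\<close> works against \<open>c i\<close>, so the
      new entry has absolute value \<open>\<bar>c i\<bar> - \<bar>c j\<bar>\<close>.\<close>
    define s where "s = - (sgn (c i) * sgn (c j))"
    have small: "\<bar>c i + s * c j\<bar> < \<bar>c i\<bar>"
      using ij(4,5) by (auto simp: s_def sgn_if)
    have "(\<Sum>k\<le>n. nat \<bar>(c(i := c i + s * c j)) k\<bar>) < (\<Sum>k\<le>n. nat \<bar>c k\<bar>)"
    proof (rule sum_strict_mono_ex1)
      show "\<exists>k\<in>{..n}. nat \<bar>(c(i := c i + s * c j)) k\<bar> < nat \<bar>c k\<bar>"
        using ij(1) small by (intro bexI[of _ i]) auto
    qed (use small in auto)
    then show ?thesis
      using transvect[OF ij(1-3)] less by blast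
  next
    case False
    show ?thesis
    proof (cases "\<exists>k<n. c k \<noteq> 0")
      case True
      then obtain k where k: "k < n" "c k \<noteq> 0"
        by blast
      with False have zero: "c j = 0" if "j \<le> n" "j \<noteq> k" for j
        using that by (meson less_imp_le)
      \<comment> \<open>The only nonzero entry is at \<open>k < n\<close>. Adding it to entry
        \<open>n\<close>, which is 0, and then subtracting entry \<open>n\<close> from entry
        \<open>k\<close> moves it to \<open>n\<close>. The first move enlarges the sum, so
        \<open>supported\<close> replaces the induction hypothesis here.\<close>
      define c' where "c' = c(n := c n + 1 * c k)"
      have "Q (c'(k := c' k + - 1 * c' n))"
        using k zero by (intro supported) (auto simp: c'_def)
      then have "Q c'"
        using k by (rule_tac transvect[of k n c' "- 1"]) auto
      then show ?thesis
        unfolding c'_def using k by (rule_tac transvect[of n k c 1]) auto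
    qed (use supported in blast)
  qed
qed

section \<open>Integral functionals that are positive on finitely many vectors\<close>

lemma finite_sets_separated:
  fixes L U :: "'a::unbounded_dense_linorder set"
  assumes "finite L" "finite U" "\<And>l u. \<lbrakk>l \<in> L; u \<in> U\<rbrakk> \<Longrightarrow> l < u"
  shows "\<exists>t. (\<forall>l\<in>L. l < t) \<and> (\<forall>u\<in>U. t < u)"
proof -
  consider "L = {}" "U = {}" | "L = {}" "U \<noteq> {}" | "L \<noteq> {}" "U = {}" | "L \<noteq> {}" "U \<noteq> {}"
    by blast
  then show ?thesis
  proof cases
    case 2
    with lt_ex[of "Min U"] assms(2) show ?thesis by auto
  next
    case 3
    with gt_ex[of "Max L"] assms(1) show ?thesis by auto
  next
    case 4
    with assms dense[of "Max L" "Min U"] show ?thesis by auto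
  qed auto
qed

lemma additive_imp_positive_multiple:
  fixes a :: "nat \<Rightarrow> int"
  assumes add: "\<And>a b. \<lbrakk>a \<in> K; b \<in> K\<rbrakk> \<Longrightarrow> (\<lambda>i. a i + b i) \<in> K"
    and "a \<in> K" "0 < k"
  shows "(\<lambda>i. k * a i) \<in> K"
  using \<open>0 < k\<close>
proof (induction k rule: int_gr_induct)
  case (step k)
  then show ?case
    using add[OF \<open>a \<in> K\<close> step(2)] by (simp add: algebra_simps)
qed (use \<open>a \<in> K\<close> in simp)

text \<open>Fourier-Motzkin elimination of the last coordinate. The semigroup \<open>K\<close> stands for the positive
  combinations of \<open>S\<close>, so that its last assumption survives the elimination.\<close>

lemma strict_separation_rat:
  fixes S K :: "(nat \<Rightarrow> int) set"
  assumes "finite S" "S \<subseteq> K"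
    and add: "\<And>a b. \<lbrakk>a \<in> K; b \<in> K\<rbrakk> \<Longrightarrow> (\<lambda>i. a i + b i) \<in> K"
    and nonzero: "\<And>a. a \<in> K \<Longrightarrow> \<exists>i<n. a i \<noteq> 0"
  shows "\<exists>c :: nat \<Rightarrow> rat. \<forall>a\<in>S. 0 < (\<Sum>i<n. c i * of_int (a i))"
  using assms
proof (induction n arbitrary: S K)
  \<comment> \<open>There are no coordinates that could be nonzero, so \<open>K\<close> and hence
    \<open>S\<close> is empty.\<close>
  case 0
  then show ?case by auto
next
  case (Suc n)
  define P where "P = {a \<in> S. 0 < a n}"
  define N where "N = {a \<in> S. a n < 0}"
  \<comment> \<open>For \<open>a \<in> P\<close> and \<open>b \<in> N\<close> both coefficients
    \<open>a n\<close> and \<open>- b n\<close> are positive, and the last coordinate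
    cancels.\<close>
  define comb :: "(nat \<Rightarrow> int) \<times> (nat \<Rightarrow> int) \<Rightarrow> nat \<Rightarrow> int"
    where "comb = (\<lambda>(a, b) i. a n * b i + (- b n) * a i)"
  have comb_in: "comb (a, b) \<in> K" if "a \<in> P" "b \<in> N" for a b
  proof -
    have "(\<lambda>i. a n * b i) \<in> K" "(\<lambda>i. (- b n) * a i) \<in> K"
      using that \<open>S \<subseteq> K\<close> unfolding P_def N_def
      by (auto intro!: additive_imp_positive_multiple[of K, OF Suc.prems(3)]
          simp del: mult_minus_left)
    from Suc.prems(3)[OF this] show ?thesis
      by (simp add: comb_def)
  qed
  \<comment> \<open>The semigroup shrinks to the members of \<open>K\<close> with last coordinate 0;
    their nonzero coordinate is then among the first \<open>n\<close>.\<close>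
  have "\<exists>c :: nat \<Rightarrow> rat. \<forall>a \<in> {a \<in> S. a n = 0} \<union> comb ` (P \<times> N).
          0 < (\<Sum>i<n. c i * of_int (a i))"
  proof (rule Suc.IH)
    show "finite ({a \<in> S. a n = 0} \<union> comb ` (P \<times> N))"
      using \<open>finite S\<close> by (simp add: P_def N_def)
    show "{a \<in> S. a n = 0} \<union> comb ` (P \<times> N) \<subseteq> {a \<in> K. a n = 0}"
      using \<open>S \<subseteq> K\<close> comb_in by (auto simp: comb_def)
    show "(\<lambda>i. a i + b i) \<in> {a \<in> K. a n = 0}"
      if "a \<in> {a \<in> K. a n = 0}" "b \<in> {a \<in> K. a n = 0}" for a b
      using that Suc.prems(3) by simp
    show "\<exists>i<n. a i \<noteq> 0" if "a \<in> {a \<in> K. a n = 0}" for a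
      using that Suc.prems(4)[of a] less_Suc_eq by auto
  qed
  then obtain c :: "nat \<Rightarrow> rat"
    where c: "\<And>a. a \<in> {a \<in> S. a n = 0} \<union> comb ` (P \<times> N) \<Longrightarrow> 0 < (\<Sum>i<n. c i * of_int (a i))"
    by blast
  define v where "v = (\<lambda>a :: nat \<Rightarrow> int. \<Sum>i<n. c i * of_int (a i))"
  \<comment> \<open>The coefficient \<open>t\<close> of the last coordinate must satisfy
    \<open>0 < v a + t * a n\<close>, which is a lower bound on \<open>t\<close> for
    \<open>a \<in> P\<close> and an upper bound for \<open>a \<in> N\<close>.\<close>
  have "\<exists>t. (\<forall>l \<in> (\<lambda>a. - v a / of_int (a n)) ` P. l < t) \<and>
            (\<forall>u \<in> (\<lambda>b. - v b / of_int (b n)) ` N. t < u)"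
  proof (rule finite_sets_separated)
    fix l u
    assume "l \<in> (\<lambda>a. - v a / of_int (a n)) ` P" "u \<in> (\<lambda>b. - v b / of_int (b n)) ` N"
    then obtain a b where ab: "a \<in> P" "b \<in> N" "l = - v a / of_int (a n)" "u = - v b / of_int (b n)"
      by blast
    \<comment> \<open>Multiplying \<open>l < u\<close> by the positive number
      \<open>- (a n * b n)\<close> turns it into positivity of \<open>v\<close> on
      \<open>comb (a, b)\<close>.\<close>
    have "0 < v (comb (a, b))"
      unfolding v_def using ab by (intro c) blast
    also have "v (comb (a, b)) = of_int (a n) * v b - of_int (b n) * v a"
      by (simp add: v_def comb_def sum_distrib_left sum_subtractf algebra_simps)
    finally show "l < u"
      unfolding ab(3,4) using ab(1,2) by (simp add: P_def N_def field_simps)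
  qed (use \<open>finite S\<close> in \<open>simp_all add: P_def N_def\<close>)
  then obtain t where t: "\<And>a. a \<in> P \<Longrightarrow> - v a / of_int (a n) < t"
      "\<And>b. b \<in> N \<Longrightarrow> t < - v b / of_int (b n)"
    unfolding ball_simps(9) by blast
  have "0 < (\<Sum>i<Suc n. (c(n := t)) i * of_int (a i))" if "a \<in> S" for a
  proof -
    have eq: "(\<Sum>i<Suc n. (c(n := t)) i * of_int (a i)) = v a + t * of_int (a n)"
      by (simp add: v_def)
    consider "a n = 0" | "a \<in> P" | "a \<in> N"
      using \<open>a \<in> S\<close> unfolding P_def N_def by force
    then show ?thesis
    proof cases
      case 1
      with c[of a] \<open>a \<in> S\<close> show ?thesis
        unfolding eq by (simp add: v_def)
    next
      case 2
      with t(1)[OF 2] show ?thesis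
        unfolding eq by (simp add: P_def field_simps)
    next
      case 3
      with t(2)[OF 3] show ?thesis
        unfolding eq by (simp add: N_def field_simps)
    qed
  qed
  then show ?case by blast
qed

lemma common_denominator:
  fixes c :: "nat \<Rightarrow> rat"
  shows "\<exists>d>0. \<exists>z :: nat \<Rightarrow> int. \<forall>i<n. of_int (z i) = of_int d * c i"
proof (induction n)
  case (Suc n)
  then obtain d and z :: "nat \<Rightarrow> int"
    where dz: "0 < d" "\<And>i. i < n \<Longrightarrow> of_int (z i) = of_int d * c i"
    by blast
  obtain p q where pq: "c n = Fract p q" "0 < q"
    by (cases "c n") auto
  then have "\<forall>i<Suc n. rat_of_int (((\<lambda>i. q * z i)(n := d * p)) i) = of_int (d * q) * c i"
    using dz(2) by (auto simp: less_Suc_eq Fract_of_int_quotient)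
  moreover have "0 < d * q"
    using dz(1) pq(2) by simp
  ultimately show ?case by blast
qed (auto intro: exI[of _ 1])

text \<open>A positive common denominator makes the rational functional integral without changing
  signs.\<close>

lemma strict_separation:
  fixes S K :: "(nat \<Rightarrow> int) set"
  assumes "finite S" "S \<subseteq> K"
    and "\<And>a b. \<lbrakk>a \<in> K; b \<in> K\<rbrakk> \<Longrightarrow> (\<lambda>i. a i + b i) \<in> K"
    and "\<And>a. a \<in> K \<Longrightarrow> \<exists>i<n. a i \<noteq> 0"
  shows "\<exists>c :: nat \<Rightarrow> int. \<forall>a\<in>S. 0 < (\<Sum>i<n. c i * a i)"
proof -
  obtain c :: "nat \<Rightarrow> rat" where c: "\<And>a. a \<in> S \<Longrightarrow> 0 < (\<Sum>i<n. c i * of_int (a i))"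
    using strict_separation_rat[OF assms] by blast
  obtain d and z :: "nat \<Rightarrow> int"
    where dz: "0 < d" "\<And>i. i < n \<Longrightarrow> of_int (z i) = of_int d * c i"
    using common_denominator by blast
  have "0 < (\<Sum>i<n. z i * a i)" if "a \<in> S" for a
  proof -
    have "rat_of_int (\<Sum>i<n. z i * a i) = of_int d * (\<Sum>i<n. c i * of_int (a i))"
      using dz(2) by (simp add: sum_distrib_left mult.assoc)
    also have "\<dots> > 0"
      using c[OF that] dz(1) by simp
    finally show ?thesis
      unfolding of_int_0_less_iff .
  qed
  then show ?thesis by blast
qed

subsection \<open>The groups \<open>\<int>\<^sup>n\<close>\<close>

lemma carrier_Zn: "carrier (Zn n) = {..<n} \<rightarrow>\<^sub>E UNIV"
  by (simp add: Zn_def)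

lemma mult_Zn: "x \<otimes>\<^bsub>Zn n\<^esub> y = (\<lambda>i\<in>{..<n}. x i + y i)"
  by (simp add: Zn_def)

lemma one_Zn: "\<one>\<^bsub>Zn n\<^esub> = (\<lambda>i\<in>{..<n}. 0)"
  by (simp add: Zn_def)

lemma comm_group_Zn: "comm_group (Zn n)"
proof (rule group.group_comm_groupI)
  show "group (Zn n)"
    by (simp add: Zn_def)
qed (simp add: mult_Zn add.commute)

lemma group_Zn: "group (Zn n)"
  using comm_group_Zn by (rule comm_group.axioms)

lemma inv_Zn: "x \<in> carrier (Zn n) \<Longrightarrow> inv\<^bsub>Zn n\<^esub> x = (\<lambda>i\<in>{..<n}. - x i)"
  unfolding Zn_def by (subst inv_product_group) (simp_all)

lemma Zn_eqI:
  "\<lbrakk>x \<in> carrier (Zn n); y \<in> carrier (Zn n); \<And>i. i < n \<Longrightarrow> x i = y i\<rbrakk> \<Longrightarrow> x = y"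
  by (auto simp: carrier_Zn intro: PiE_ext)

lemma hom_Zn_coordinate: "i < n \<Longrightarrow> (\<lambda>x. x i) \<in> hom (Zn n) integer_group"
  by (auto simp: hom_def mult_Zn)

lemma nat_pow_Zn:
  "\<lbrakk>x \<in> carrier (Zn n); i < n\<rbrakk> \<Longrightarrow> (x [^]\<^bsub>Zn n\<^esub> (k :: nat)) i = int k * x i"
  using hom_nat_pow[OF hom_Zn_coordinate _ group_Zn group_integer_group] by fastforce

lemma int_pow_Zn:
  "\<lbrakk>x \<in> carrier (Zn n); i < n\<rbrakk> \<Longrightarrow> (x [^]\<^bsub>Zn n\<^esub> (k :: int)) i = k * x i"
  using hom_int_pow[OF hom_Zn_coordinate _ group_Zn group_integer_group] by fastforce

lemma torsion_free_Zn: "torsion_free (Zn n)"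
  unfolding torsion_free_def
proof (intro ballI allI impI)
  fix x and k :: nat
  assume x: "x \<in> carrier (Zn n)" and "0 < k" and "x [^]\<^bsub>Zn n\<^esub> k = \<one>\<^bsub>Zn n\<^esub>"
  then have "int k * x i = 0" if "i < n" for i
    using nat_pow_Zn[OF x that, of k] that by (simp add: one_Zn)
  with \<open>0 < k\<close> x show "x = \<one>\<^bsub>Zn n\<^esub>"
    by (intro Zn_eqI[of _ n]) (auto simp: one_Zn carrier_Zn)
qed

text \<open>For \<open>j \<ge> n\<close> this is the zero vector, so membership in the carrier needs
  no bound on \<open>j\<close>.\<close>

definition unit_vector :: "nat \<Rightarrow> nat \<Rightarrow> nat \<Rightarrow> int" where
  "unit_vector n j = (\<lambda>i\<in>{..<n}. if i = j then 1 else 0)"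

lemma unit_vector_carrier: "unit_vector n j \<in> carrier (Zn n)"
  by (simp add: unit_vector_def carrier_Zn)

section \<open>Homomorphisms from Z^n and generating families\<close>

lemma (in comm_group) hom_Zn_eq_finprod:
  assumes k: "k \<in> hom (Zn n) G" and x: "x \<in> carrier (Zn n)"
  shows "k x = (\<Otimes>i\<in>{..<n}. k (unit_vector n i) [^] x i)"
proof -
  have kc: "k y \<in> carrier G" if "y \<in> carrier (Zn n)" for y
    using k that by (rule hom_in_carrier)
  \<comment> \<open>Induction over the truncations of \<open>x\<close> to its first \<open>m\<close>
    coordinates: each step adds a multiple of one unit vector, and \<open>m = n\<close> gives
    \<open>x\<close>.\<close>
  have "k (\<lambda>i\<in>{..<n}. if i < m then x i else 0) = (\<Otimes>i\<in>{..<m}. k (unit_vector n i) [^] x i)"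
    if "m \<le> n" for m
    using that
  proof (induction m)
    case 0
    then show ?case
      using hom_one[OF k group_Zn is_group] by (simp add: one_Zn restrict_def)
  next
    case (Suc m)
    let ?x = "\<lambda>m. \<lambda>i\<in>{..<n}. if i < m then x i else 0"
    have step: "?x (Suc m) = unit_vector n m [^]\<^bsub>Zn n\<^esub> x m \<otimes>\<^bsub>Zn n\<^esub> ?x m"
    proof (rule Zn_eqI)
      show "unit_vector n m [^]\<^bsub>Zn n\<^esub> x m \<otimes>\<^bsub>Zn n\<^esub> ?x m \<in> carrier (Zn n)"
        by (simp add: mult_Zn carrier_Zn)
      show "?x (Suc m) i = (unit_vector n m [^]\<^bsub>Zn n\<^esub> x m \<otimes>\<^bsub>Zn n\<^esub> ?x m) i" if "i < n" for i
        using that int_pow_Zn[OF unit_vector_carrier that] by (auto simp: mult_Zn unit_vector_def less_Suc_eq)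
    qed (simp add: carrier_Zn)
    have "k (?x (Suc m)) = k (unit_vector n m) [^] x m \<otimes> k (?x m)"
      unfolding step using hom_int_pow[OF k unit_vector_carrier group_Zn is_group]
        group.int_pow_closed[OF group_Zn unit_vector_carrier]
      by (subst hom_mult[OF k]) (auto simp: carrier_Zn)
    also have "\<dots> = k (unit_vector n m) [^] x m \<otimes> (\<Otimes>i\<in>{..<m}. k (unit_vector n i) [^] x i)"
      using Suc.IH[OF Suc_leD[OF Suc.prems]] by (rule arg_cong)
    also have "\<dots> = (\<Otimes>i\<in>{..<Suc m}. k (unit_vector n i) [^] x i)"
      unfolding lessThan_Suc
      by (rule finprod_insert[symmetric]) (auto intro: kc[OF unit_vector_carrier])
    finally show ?case .
  qed
  from this[OF order_refl] have "k (\<lambda>i\<in>{..<n}. if i < n then x i else 0) = (\<Otimes>i\<in>{..<n}. k (unit_vector n i) [^] x i)"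
    .
  moreover have "(\<lambda>i\<in>{..<n}. if i < n then x i else 0) = x"
    using x by (intro Zn_eqI) (auto simp: carrier_Zn)
  ultimately show ?thesis by metis
qed

lemma (in comm_group) finprod_int_pow_hom:
  assumes "g \<in> {..<n} \<rightarrow> carrier G"
  shows "(\<lambda>x. \<Otimes>i\<in>{..<n}. g i [^] x i) \<in> hom (Zn n) G"
proof (rule homI)
  fix x y :: "nat \<Rightarrow> int"
  show "(\<Otimes>i\<in>{..<n}. g i [^] x i) \<in> carrier G"
    using assms by (auto intro!: finprod_closed)
  have "(\<Otimes>i\<in>{..<n}. g i [^] (x \<otimes>\<^bsub>Zn n\<^esub> y) i) = (\<Otimes>i\<in>{..<n}. g i [^] x i \<otimes> g i [^] y i)"
    using assms by (intro finprod_cong') (auto simp: mult_Zn int_pow_mult Pi_iff)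
  also have "\<dots> = (\<Otimes>i\<in>{..<n}. g i [^] x i) \<otimes> (\<Otimes>i\<in>{..<n}. g i [^] y i)"
    using assms by (intro finprod_multf) auto
  finally show "(\<Otimes>i\<in>{..<n}. g i [^] (x \<otimes>\<^bsub>Zn n\<^esub> y) i)
      = (\<Otimes>i\<in>{..<n}. g i [^] x i) \<otimes> (\<Otimes>i\<in>{..<n}. g i [^] y i)" .
qed

lemma (in comm_group) finprod_int_pow_unit_vector:
  assumes "g \<in> {..<n} \<rightarrow> carrier G" "j < n"
  shows "(\<Otimes>i\<in>{..<n}. g i [^] unit_vector n j i) = g j"
proof -
  have "(\<Otimes>i\<in>{..<n}. g i [^] unit_vector n j i) = (\<Otimes>i\<in>{..<n}. if j = i then g i else \<one>)"
    using assms by (intro finprod_cong') (auto simp: unit_vector_def Pi_iff)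
  also have "\<dots> = g j"
    using assms by (intro finprod_singleton) auto
  finally show ?thesis .
qed

lemma (in comm_group) finprod_mem_subgroup:
  assumes H: "subgroup H G" and "finite A" "\<And>i. i \<in> A \<Longrightarrow> f i \<in> H"
  shows "finprod G f A \<in> H"
  using assms(2,3)
proof (induction A)
  case empty
  then show ?case
    using subgroup.one_closed[OF H] by simp
next
  case (insert i A)
  then show ?case
    using subgroup.subset[OF H] by (auto simp: Pi_iff subset_iff subgroup.m_closed[OF H])
qed

text \<open>The image is a subgroup and contains each generator as the value at a unit
  vector.\<close>

lemma (in comm_group) epi_Zn_of_generators:
  assumes g: "g ` {..<n} \<subseteq> carrier G" and gen: "generate G (g ` {..<n}) = carrier G"
  shows "(\<lambda>x. \<Otimes>i\<in>{..<n}. g i [^] x i) \<in> epi (Zn n) G"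
proof -
  let ?f = "\<lambda>x. \<Otimes>i\<in>{..<n}. g i [^] x i"
  have g': "g \<in> {..<n} \<rightarrow> carrier G"
    using g by blast
  have hom: "?f \<in> hom (Zn n) G"
    using g' by (rule finprod_int_pow_hom)
  interpret f: group_hom "Zn n" G ?f
    using hom group_Zn is_group by (simp add: group_hom_def group_hom_axioms_def)
  have "g ` {..<n} \<subseteq> ?f ` carrier (Zn n)"
  proof
    fix y
    assume "y \<in> g ` {..<n}"
    then obtain j where "j < n" "y = g j"
      by blast
    then have "y = ?f (unit_vector n j)"
      using finprod_int_pow_unit_vector[OF g'] by simp
    then show "y \<in> ?f ` carrier (Zn n)"
      using unit_vector_carrier by blast
  qed
  then have "carrier G \<subseteq> ?f ` carrier (Zn n)"
    using f.img_is_subgroup unfolding gen[symmetric] by (rule generate_subgroup_incl)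
  moreover have "?f ` carrier (Zn n) \<subseteq> carrier G"
    using f.img_is_subgroup by (rule subgroup.subset)
  ultimately show ?thesis
    using hom by (simp add: epi_iff_subset)
qed

text \<open>Every value of \<open>k\<close> is a product of powers of its values at the unit
  vectors.\<close>

lemma (in comm_group) generate_image_unit_vectors:
  assumes k: "k \<in> epi (Zn n) G"
  shows "generate G ((\<lambda>i. k (unit_vector n i)) ` {..<n}) = carrier G"
proof -
  let ?U = "(\<lambda>i. k (unit_vector n i)) ` {..<n}"
  have hom: "k \<in> hom (Zn n) G" and surj: "k ` carrier (Zn n) = carrier G"
    using k by (auto simp: epi_def)
  have U: "?U \<subseteq> carrier G"
    using hom_in_carrier[OF hom unit_vector_carrier] by auto
  have sub: "subgroup (generate G ?U) G"
    using U by (rule generate_is_subgroup)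
  have "k x \<in> generate G ?U" if "x \<in> carrier (Zn n)" for x
    unfolding hom_Zn_eq_finprod[OF hom that]
  proof (rule finprod_mem_subgroup[OF sub])
    show "k (unit_vector n i) [^] x i \<in> generate G ?U" if "i \<in> {..<n}" for i
      using that by (intro subgroup_int_pow_closed[OF sub] generate.incl) blast
  qed simp
  then have "carrier G \<subseteq> generate G ?U"
    unfolding surj[symmetric] by (rule image_subsetI)
  with generate_incl[OF U] show ?thesis
    by (rule subset_antisym)
qed

section \<open>Elementary automorphisms of Z^n\<close>

definition transvection :: "nat \<Rightarrow> nat \<Rightarrow> int \<Rightarrow> (nat \<Rightarrow> int) \<Rightarrow> nat \<Rightarrow> int" where
  "transvection i j s x = x(i := x i + s * x j)"

lemma transvection_inverse: "i \<noteq> j \<Longrightarrow> transvection i j (- s) (transvection i j s x) = x"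
  by (simp add: transvection_def)

text \<open>Reduces automorphisms to identities in the coordinates below \<open>n\<close>;
  bijectivity comes from the two-sided inverse \<open>h'\<close>.\<close>

lemma Zn_automorphismI:
  assumes closed: "\<And>x. x \<in> carrier (Zn n) \<Longrightarrow> h x \<in> carrier (Zn n)"
      "\<And>x. x \<in> carrier (Zn n) \<Longrightarrow> h' x \<in> carrier (Zn n)"
    and add: "\<And>x y k. \<lbrakk>x \<in> carrier (Zn n); y \<in> carrier (Zn n); k < n\<rbrakk>
      \<Longrightarrow> h (\<lambda>i\<in>{..<n}. x i + y i) k = h x k + h y k"
    and inverse: "\<And>x k. \<lbrakk>x \<in> carrier (Zn n); k < n\<rbrakk> \<Longrightarrow> h' (h x) k = x k"
      "\<And>x k. \<lbrakk>x \<in> carrier (Zn n); k < n\<rbrakk> \<Longrightarrow> h (h' x) k = x k"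
  shows "h \<in> iso (Zn n) (Zn n)"
proof (rule isoI)
  have mult_closed: "x \<otimes>\<^bsub>Zn n\<^esub> y \<in> carrier (Zn n)"
    if "x \<in> carrier (Zn n)" "y \<in> carrier (Zn n)" for x y
    by (simp add: carrier_Zn mult_Zn)
  show "h \<in> hom (Zn n) (Zn n)"
  proof (rule homI)
    fix x y
    assume xy: "x \<in> carrier (Zn n)" "y \<in> carrier (Zn n)"
    show "h (x \<otimes>\<^bsub>Zn n\<^esub> y) = h x \<otimes>\<^bsub>Zn n\<^esub> h y"
    proof (rule Zn_eqI)
      show "h (x \<otimes>\<^bsub>Zn n\<^esub> y) k = (h x \<otimes>\<^bsub>Zn n\<^esub> h y) k" if "k < n" for k
        using add[OF xy that] that by (simp add: mult_Zn)
    qed (use xy closed mult_closed in auto)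
  qed (rule closed)
  show "bij_betw h (carrier (Zn n)) (carrier (Zn n))"
  proof (rule bij_betw_byWitness[where f' = h'])
    show "\<forall>x\<in>carrier (Zn n). h' (h x) = x" "\<forall>x\<in>carrier (Zn n). h (h' x) = x"
      using closed inverse by (metis Zn_eqI)+
  qed (use closed in blast)+
qed

lemma transvection_iso:
  assumes "i < n" "j < n" "i \<noteq> j"
  shows "transvection i j s \<in> iso (Zn n) (Zn n)"
proof (rule Zn_automorphismI[where h' = "transvection i j (- s)"])
  show "transvection i j s x \<in> carrier (Zn n)" "transvection i j (- s) x \<in> carrier (Zn n)"
    if "x \<in> carrier (Zn n)" for x
    using that \<open>i < n\<close> by (simp_all add: transvection_def carrier_Zn PiE_iff extensional_def)
  show "transvection i j s (\<lambda>i\<in>{..<n}. x i + y i) k = transvection i j s x k + transvection i j s y k"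
    if "k < n" for x y k
    using that assms by (simp add: transvection_def distrib_left)
qed (use assms in \<open>simp_all add: transvection_def\<close>)

subsection \<open>Torsion-free quotients of \<open>\<int>\<^sup>n\<close>\<close>

text \<open>The relation \<open>c\<close> is a nonzero multiple of the last unit vector, whose image
  is therefore torsion, hence trivial. The images of the other unit vectors still generate
  \<open>G\<close>.\<close>

lemma (in comm_group) epi_Zn_drop_coordinate:
  assumes tf: "torsion_free G" and k: "k \<in> epi (Zn (Suc n)) G"
    and c: "c \<in> carrier (Zn (Suc n))" "c \<noteq> \<one>\<^bsub>Zn (Suc n)\<^esub>" "k c = \<one>"
    and supp: "\<forall>i<n. c i = 0"
  shows "\<exists>k'. k' \<in> epi (Zn n) G"
proof -
  let ?g = "\<lambda>i. k (unit_vector (Suc n) i)"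
  have hom: "k \<in> hom (Zn (Suc n)) G"
    using k by (simp add: epi_def)
  have g: "?g i \<in> carrier G" for i
    using hom unit_vector_carrier by (rule hom_in_carrier)
  have "c n \<noteq> 0"
  proof
    assume "c n = 0"
    then have "c = \<one>\<^bsub>Zn (Suc n)\<^esub>"
      using c(1) supp by (intro Zn_eqI[of _ "Suc n"]) (auto simp: one_Zn carrier_Zn less_Suc_eq)
    with c(2) show False ..
  qed
  have "c = unit_vector (Suc n) n [^]\<^bsub>Zn (Suc n)\<^esub> c n"
  proof (rule Zn_eqI)
    show "c i = (unit_vector (Suc n) n [^]\<^bsub>Zn (Suc n)\<^esub> c n) i" if "i < Suc n" for i
      using that supp by (subst int_pow_Zn[OF unit_vector_carrier]) (auto simp: unit_vector_def)
  qed (use c(1) group.int_pow_closed[OF group_Zn unit_vector_carrier] in auto)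
  then have "k c = ?g n [^] c n"
    using hom_int_pow[OF hom unit_vector_carrier group_Zn is_group] by metis
  with c(3) have pow: "?g n [^] c n = \<one>"
    by simp
  \<comment> \<open>\<open>torsion_free\<close> speaks of natural exponents, while
    \<open>c n\<close> may be negative.\<close>
  have "?g n [^] nat \<bar>c n\<bar> = ?g n [^] \<bar>c n\<bar>"
    by (rule pow_nat) simp
  also have "\<dots> = \<one>"
    using pow int_pow_neg[OF g, of n "c n"] by (simp add: abs_if)
  finally have gn: "?g n = \<one>"
    using tf g \<open>c n \<noteq> 0\<close> unfolding torsion_free_def by (metis zero_less_abs_iff zero_less_nat_eq)
  have sub: "subgroup (generate G (?g ` {..<n})) G"
    using g by (intro generate_is_subgroup) blast
  have "?g ` {..<Suc n} \<subseteq> generate G (?g ` {..<n})"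
  proof (rule image_subsetI)
    fix i
    assume "i \<in> {..<Suc n}"
    then consider "i < n" | "i = n"
      by fastforce
    then show "?g i \<in> generate G (?g ` {..<n})"
    proof cases
      case 1
      then show ?thesis by (intro generate.incl) blast
    next
      case 2
      then show ?thesis using gn by (simp add: generate.one)
    qed
  qed
  then have "carrier G \<subseteq> generate G (?g ` {..<n})"
    using sub unfolding generate_image_unit_vectors[OF k, symmetric]
    by (rule generate_subgroup_incl)
  then have "generate G (?g ` {..<n}) = carrier G"
    using subgroup.subset[OF sub] by (intro subset_antisym)
  moreover have "?g ` {..<n} \<subseteq> carrier G"
    using g by blast
  ultimately show ?thesis
    using epi_Zn_of_generators[of ?g n] by blast
qed

text \<open>Changing the relation \<open>c\<close> by an automorphism and precomposing
  \<open>k\<close> with the inverse automorphism gives a surjection with the changed relation, so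
  Euclid's algorithm applies to \<open>c\<close>.\<close>

lemma (in comm_group) epi_Zn_eliminate_generator:
  assumes tf: "torsion_free G" and "k \<in> epi (Zn (Suc n)) G"
    and "c \<in> carrier (Zn (Suc n))" "c \<noteq> \<one>\<^bsub>Zn (Suc n)\<^esub>" "k c = \<one>"
  shows "\<exists>k'. k' \<in> epi (Zn n) G"
  using assms(2-)
proof (induction c arbitrary: k rule: transvection_induct[where n = n])
  case (transvect c i j s)
  then have ij: "i < Suc n" "j < Suc n" "i \<noteq> j"
    by auto
  have c': "c(i := c i + s * c j) = transvection i j s c"
    by (simp add: transvection_def)
  have iso: "transvection i j s \<in> iso (Zn (Suc n)) (Zn (Suc n))" for s
    using ij by (rule transvection_iso)
  show ?case
  proof (rule transvect.IH)
    show "k \<circ> transvection i j (- s) \<in> epi (Zn (Suc n)) G"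
      using iso transvect.prems(1) by (intro epi_compose) (auto simp: iso_iff_mon_epi)
    show "c(i := c i + s * c j) \<in> carrier (Zn (Suc n))"
      unfolding c' using transvect.prems(2) iso by (auto simp: iso_def dest: hom_in_carrier)
    show "(k \<circ> transvection i j (- s)) (c(i := c i + s * c j)) = \<one>"
      unfolding c' using transvect.prems(4) transvection_inverse[OF ij(3)] by simp
    show "c(i := c i + s * c j) \<noteq> \<one>\<^bsub>Zn (Suc n)\<^esub>"
    proof
      assume "c(i := c i + s * c j) = \<one>\<^bsub>Zn (Suc n)\<^esub>"
      then have "transvection i j s c = transvection i j s \<one>\<^bsub>Zn (Suc n)\<^esub>"
        using hom_one[OF _ group_Zn group_Zn, of "transvection i j s" "Suc n" "Suc n"] iso[of s]
        by (simp add: c' iso_def)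
      then have "c = \<one>\<^bsub>Zn (Suc n)\<^esub>"
        using transvection_inverse[OF ij(3)] by metis
      with transvect.prems(3) show False ..
    qed
  qed
next
  case (supported c)
  with tf show ?case
    by (intro epi_Zn_drop_coordinate)
qed

text \<open>Induction on the number of generators: a surjection that is not injective has a
  nontrivial relation, which saves a generator.\<close>

lemma (in comm_group) torsion_free_epi_Zn_imp_iso:
  assumes "torsion_free G" "k \<in> epi (Zn n) G"
  shows "\<exists>m h. h \<in> iso (Zn m) G"
  using assms(2)
proof (induction n arbitrary: k)
  case (Suc n)
  show ?case
  proof (cases "inj_on k (carrier (Zn (Suc n)))")
    case True
    with Suc.prems have "k \<in> iso (Zn (Suc n)) G"
      by (simp add: iso_iff_mon_epi mon_def epi_def)
    then show ?thesis by blast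
  next
    case False
    then obtain c where "c \<in> carrier (Zn (Suc n))" "c \<noteq> \<one>\<^bsub>Zn (Suc n)\<^esub>" "k c = \<one>"
      using inj_on_one_iff'[OF _ group_Zn is_group] Suc.prems by (auto simp: epi_def)
    with assms(1) Suc show ?thesis
      using epi_Zn_eliminate_generator by blast
  qed
next
  case 0
  have "inj_on k (carrier (Zn 0))"
    by (auto simp: carrier_Zn)
  with 0 have "k \<in> iso (Zn 0) G"
    by (simp add: iso_iff_mon_epi mon_def epi_def)
  then show ?case by blast
qed

subsection \<open>Moving pointed cones into the nonnegative orthant\<close>

text \<open>A functional supported on the last coordinate that is positive on \<open>S\<close> makes that coordinate
  positive up to sign, and adding a large multiple of it makes the other coordinates nonnegative.
  Transvections reduce the general case to this one.\<close>

lemma automorphism_into_nonneg_vectors: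
  fixes c :: "nat \<Rightarrow> int"
  assumes "finite S" "S \<subseteq> carrier (Zn (Suc n))"
    and "\<And>q. q \<in> S \<Longrightarrow> 0 < (\<Sum>i\<le>n. c i * q i)"
  shows "\<exists>h \<in> iso (Zn (Suc n)) (Zn (Suc n)). h ` S \<subseteq> nonneg_vectors (Suc n)"
  using assms
proof (induction c arbitrary: S rule: transvection_induct[where n = n])
  case (transvect c i j s)
  then have ij: "i < Suc n" "j < Suc n" "j \<noteq> i"
    by auto
  \<comment> \<open>The functional changes by adding \<open>s * c j\<close> to its coefficient at
    \<open>i\<close>. The dual change of vectors, with \<open>i\<close> and \<open>j\<close>
    exchanged and \<open>s\<close> negated, leaves all values unchanged.\<close>
  define f where "f = transvection j i (- s)"
  have f: "f \<in> iso (Zn (Suc n)) (Zn (Suc n))"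
    unfolding f_def using ij(2,1,3) by (rule transvection_iso)
  have "\<exists>h \<in> iso (Zn (Suc n)) (Zn (Suc n)). h ` (f ` S) \<subseteq> nonneg_vectors (Suc n)"
  proof (rule transvect.IH)
    show "finite (f ` S)"
      using transvect.prems(1) by simp
    show "f ` S \<subseteq> carrier (Zn (Suc n))"
      using f transvect.prems(2) by (auto simp: iso_def dest: hom_in_carrier)
    fix q'
    assume "q' \<in> f ` S"
    then obtain q where q: "q \<in> S" "q' = f q"
      by blast
    have "(\<Sum>k\<le>n. (c(i := c i + s * c j)) k * q' k) =
        (\<Sum>k\<le>n. c k * q k + (if k = i then s * c j * q i else 0) + (if k = j then - (s * c j * q i) else 0))"
      using ij unfolding q(2) f_def transvection_def
      by (intro sum.cong) (auto simp: algebra_simps)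
    also have "\<dots> = (\<Sum>k\<le>n. c k * q k)"
      using ij by (simp add: sum.distrib)
    finally show "0 < (\<Sum>k\<le>n. (c(i := c i + s * c j)) k * q' k)"
      using transvect.prems(3)[OF q(1)] by simp
  qed
  then obtain h where "h \<in> iso (Zn (Suc n)) (Zn (Suc n))" "h ` (f ` S) \<subseteq> nonneg_vectors (Suc n)"
    by blast
  then show ?case
    using iso_set_trans[OF f] by (intro bexI[of _ "h \<circ> f"]) (auto simp: image_comp)
next
  case (supported c)
  \<comment> \<open>The sign for which \<open>e * q n\<close> is positive on \<open>S\<close>. If
    \<open>c n = 0\<close>, which forces \<open>S\<close> to be empty, the value 1 keeps
    \<open>h\<close> invertible.\<close>
  define e :: int where "e = (if c n < 0 then - 1 else 1)"
  have e: "e * e = 1" "e * (e * z) = z" for z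
    by (simp_all add: e_def)
  \<comment> \<open>A common bound for the absolute values of all coordinates of \<open>S\<close>;
    as \<open>e * q n \<ge> 1\<close>, adding \<open>N * (e * q n)\<close> makes any of them
    nonnegative.\<close>
  define N where "N = (\<Sum>q\<in>S. \<Sum>i\<le>n. \<bar>q i\<bar>)"
  define h where "h = (\<lambda>x. \<lambda>i\<in>{..<Suc n}. if i = n then e * x n else x i + N * (e * x n))"
  \<comment> \<open>The last coordinate of \<open>h x\<close> already carries the factor
    \<open>e\<close>, so \<open>h'\<close> subtracts \<open>N * x n\<close> without it.\<close>
  define h' where "h' = (\<lambda>x. \<lambda>i\<in>{..<Suc n}. if i = n then e * x n else x i - N * x n)"
  have "h \<in> iso (Zn (Suc n)) (Zn (Suc n))"
    by (rule Zn_automorphismI[where h' = h'])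
      (auto simp: h_def h'_def carrier_Zn e algebra_simps)
  moreover have "h q \<in> nonneg_vectors (Suc n)" if "q \<in> S" for q
  proof -
    have "(\<Sum>i\<le>n. c i * q i) = c n * q n"
      using supported.hyps by (simp add: atMost_Suc lessThan_Suc_atMost[symmetric] lessThan_Suc)
    with supported.prems(3)[OF that] have "1 \<le> e * q n"
      by (auto simp: e_def zero_less_mult_iff)
    moreover have "0 \<le> N"
      by (simp add: N_def sum_nonneg)
    moreover have "- q i \<le> N" if "i \<le> n" for i
    proof -
      have "\<bar>q i\<bar> \<le> (\<Sum>i\<le>n. \<bar>q i\<bar>)"
        using that by (intro member_le_sum) auto
      also have "\<dots> \<le> N"
        unfolding N_def using \<open>q \<in> S\<close> supported.prems(1)
        by (intro member_le_sum) (auto simp: sum_nonneg)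
      finally show ?thesis by linarith
    qed
    moreover have "N * 1 \<le> N * (e * q n)"
      using calculation(1,2) by (intro mult_left_mono)
    ultimately have "0 \<le> q i + N * (e * q n)" if "i \<le> n" for i
      using that by fastforce
    with \<open>1 \<le> e * q n\<close> show ?thesis
      by (auto simp: nonneg_vectors_def h_def)
  qed
  ultimately show ?case by blast
qed

section \<open>Generated submonoids and their images\<close>

lemma generated_submonoid_least:
  "\<lbrakk>submonoid N M; S \<subseteq> N\<rbrakk> \<Longrightarrow> generated_submonoid M S \<subseteq> N"
  unfolding generated_submonoid_def by blast

lemma generated_submonoid_superset: "S \<subseteq> generated_submonoid M S"
  unfolding generated_submonoid_def by blast

lemma (in monoid) submonoid_generated_submonoid:
  assumes "S \<subseteq> carrier G"
  shows "submonoid (generated_submonoid G S) G"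
proof
  have "submonoid (carrier G) G"
    by unfold_locales auto
  with assms show "generated_submonoid G S \<subseteq> carrier G"
    by (intro generated_submonoid_least)
qed (auto simp: generated_submonoid_def submonoid.m_closed submonoid.one_closed)

text \<open>Both inclusions hold by minimality, applied to the preimage of the right-hand side and
  to the left-hand side.\<close>

lemma (in group_hom) image_generated_submonoid:
  assumes S: "S \<subseteq> carrier G"
  shows "h ` generated_submonoid G S = generated_submonoid H (h ` S)"
proof
  have hS: "h ` S \<subseteq> carrier H"
    using S by auto
  interpret N: submonoid "generated_submonoid H (h ` S)" H
    using hS by (rule H.submonoid_generated_submonoid)
  interpret M: submonoid "generated_submonoid G S" G
    using S by (rule G.submonoid_generated_submonoid)
  have "submonoid {x \<in> carrier G. h x \<in> generated_submonoid H (h ` S)} G"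
    by unfold_locales auto
  then have "generated_submonoid G S \<subseteq> {x \<in> carrier G. h x \<in> generated_submonoid H (h ` S)}"
    using S generated_submonoid_superset[of "h ` S" H] by (intro generated_submonoid_least) auto
  then show "h ` generated_submonoid G S \<subseteq> generated_submonoid H (h ` S)"
    by blast
  have "submonoid (h ` generated_submonoid G S) H"
  proof
    show "x \<otimes>\<^bsub>H\<^esub> y \<in> h ` generated_submonoid G S"
      if xy: "x \<in> h ` generated_submonoid G S" "y \<in> h ` generated_submonoid G S" for x y
    proof -
      obtain a b where ab: "a \<in> generated_submonoid G S" "b \<in> generated_submonoid G S" "x = h a" "y = h b"
        using xy by blast
      then have "x \<otimes>\<^bsub>H\<^esub> y = h (a \<otimes> b)"
        by simp
      with ab M.m_closed show ?thesis by blast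
    qed
    show "\<one>\<^bsub>H\<^esub> \<in> h ` generated_submonoid G S"
      using M.one_closed hom_one by (metis image_eqI)
  qed auto
  then show "generated_submonoid H (h ` S) \<subseteq> h ` generated_submonoid G S"
    by (rule generated_submonoid_least) (intro image_mono generated_submonoid_superset)
qed

lemma (in group_hom) fg_submonoid_image:
  assumes "fg_submonoid P G"
  shows "fg_submonoid (h ` P) H"
proof -
  obtain S where S: "finite S" "S \<subseteq> carrier G" "P = generated_submonoid G S"
    using assms by (auto simp: fg_submonoid_def)
  have "h ` P = generated_submonoid H (h ` S)" "h ` S \<subseteq> carrier H"
    using S image_generated_submonoid by auto
  with S(1) show ?thesis
    unfolding fg_submonoid_def by (metis H.submonoid_generated_submonoid finite_imageI)
qed

lemma submonoid_nonneg_vectors: "submonoid (nonneg_vectors n) (Zn n)"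
  by unfold_locales (auto simp: nonneg_vectors_def carrier_Zn mult_Zn one_Zn PiE_iff)

text \<open>Separates the nonzero generators of \<open>Q\<close> from \<open>0\<close> by an integral functional.\<close>

lemma pointed_fg_submonoid_into_nonneg_vectors:
  assumes Q: "fg_submonoid Q (Zn n)"
    and pointed: "\<And>x y. \<lbrakk>x \<in> Q; y \<in> Q; x \<otimes>\<^bsub>Zn n\<^esub> y = \<one>\<^bsub>Zn n\<^esub>\<rbrakk> \<Longrightarrow> x = \<one>\<^bsub>Zn n\<^esub>"
  shows "\<exists>h \<in> iso (Zn n) (Zn n). h ` Q \<subseteq> nonneg_vectors n"
proof (cases n)
  case 0
  have "Q \<subseteq> nonneg_vectors n"
    using Q by (auto simp: fg_submonoid_def submonoid_def carrier_Zn nonneg_vectors_def 0)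
  then show ?thesis
    using iso_set_refl by (intro bexI[of _ "\<lambda>x. x"]) auto
next
  case (Suc m)
  obtain S where S: "finite S" "S \<subseteq> carrier (Zn n)" "Q = generated_submonoid (Zn n) S"
    using Q by (auto simp: fg_submonoid_def)
  interpret Q: submonoid Q "Zn n"
    using Q by (simp add: fg_submonoid_def)
  \<comment> \<open>No functional is positive at zero, so the zero generator is set aside.\<close>
  define S' where "S' = S - {\<one>\<^bsub>Zn n\<^esub>}"
  \<comment> \<open>Membership is tested after restriction because pointwise sums of vectors need
    not be \<open>undefined\<close> outside \<open>{..<n}\<close>.\<close>
  define K where "K = {a. restrict a {..<n} \<in> Q - {\<one>\<^bsub>Zn n\<^esub>}}"
  have "\<exists>c :: nat \<Rightarrow> int. \<forall>a\<in>S'. 0 < (\<Sum>i<n. c i * a i)"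
  proof (rule strict_separation)
    show "finite S'"
      using S(1) by (simp add: S'_def)
    show "S' \<subseteq> K"
    proof
      fix a
      assume a: "a \<in> S'"
      then have "restrict a {..<n} = a"
        using S(2) by (auto simp: S'_def carrier_Zn intro: PiE_restrict)
      with a show "a \<in> K"
        using S(3) generated_submonoid_superset[of S "Zn n"] by (auto simp: K_def S'_def)
    qed
    show "(\<lambda>i. a i + b i) \<in> K" if "a \<in> K" "b \<in> K" for a b
    proof -
      have "restrict (\<lambda>i. a i + b i) {..<n} = restrict a {..<n} \<otimes>\<^bsub>Zn n\<^esub> restrict b {..<n}"
        by (auto simp: mult_Zn)
      moreover have "\<dots> \<in> Q" "\<dots> \<noteq> \<one>\<^bsub>Zn n\<^esub>"
        \<comment> \<open>By pointedness, a sum of two nonzero elements of \<open>Q\<close> cannot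
          vanish.\<close>
        using that pointed by (auto simp: K_def)
      ultimately show ?thesis
        by (simp add: K_def)
    qed
    show "\<exists>i<n. a i \<noteq> 0" if "a \<in> K" for a
    proof (rule ccontr)
      assume "\<not> (\<exists>i<n. a i \<noteq> 0)"
      then have "restrict a {..<n} = \<one>\<^bsub>Zn n\<^esub>"
        by (auto simp: one_Zn)
      with that show False
        by (simp add: K_def)
    qed
  qed
  then obtain c :: "nat \<Rightarrow> int" where c: "\<And>a. a \<in> S' \<Longrightarrow> 0 < (\<Sum>i<n. c i * a i)"
    by blast
  have "\<exists>h \<in> iso (Zn (Suc m)) (Zn (Suc m)). h ` S' \<subseteq> nonneg_vectors (Suc m)"
    using S c by (intro automorphism_into_nonneg_vectors[where c = c]) (auto simp: S'_def Suc lessThan_Suc_atMost)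
  then obtain h where h: "h \<in> iso (Zn n) (Zn n)" "h ` S' \<subseteq> nonneg_vectors n"
    unfolding Suc by blast
  interpret h: group_hom "Zn n" "Zn n" h
    using h(1) group_Zn by (simp add: group_hom_def group_hom_axioms_def iso_def)
  have "h ` S \<subseteq> nonneg_vectors n"
    using h(2) submonoid.one_closed[OF submonoid_nonneg_vectors] by (force simp: S'_def)
  then have "h ` Q \<subseteq> nonneg_vectors n"
    unfolding S(3) h.image_generated_submonoid[OF S(2)]
    by (intro generated_submonoid_least submonoid_nonneg_vectors)
  with h(1) show ?thesis by blast
qed

subsection \<open>Partially ordered abelian groups\<close>

lemma torsion_free_mon:
  assumes "torsion_free H" "h \<in> mon G H" "group G" "group H"
  shows "torsion_free G"
proof -
  interpret group_hom G H h
    using assms by (simp add: mon_def group_hom_def group_hom_axioms_def)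
  show ?thesis
    unfolding torsion_free_def
  proof (intro ballI allI impI)
    fix x and k :: nat
    assume x: "x \<in> carrier G" "0 < k" "x [^]\<^bsub>G\<^esub> k = \<one>\<^bsub>G\<^esub>"
    then have "h x [^]\<^bsub>H\<^esub> k = \<one>\<^bsub>H\<^esub>"
      using hom_nat_pow[of x k] by simp
    with assms(1) hom_closed[OF x(1)] x(2) have "h x = \<one>\<^bsub>H\<^esub>"
      by (simp add: torsion_free_def)
    with x(1) assms(2) show "x = \<one>\<^bsub>G\<^esub>"
      by (simp add: mon_def inj_on_one_iff)
  qed
qed

text \<open>The images of the unit vectors serve as generators; their products of powers are the
  values of \<open>k\<close>.\<close>

lemma finitely_presentedI:
  fixes G (structure)
  assumes "comm_group G" "k \<in> iso (Zn n) G"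
    and fg: "fg_submonoid {x \<in> carrier (Zn n). \<one>\<^bsub>G\<^esub> \<preceq>\<^bsub>G\<^esub> k x} (Zn n)"
  shows "finitely_presented G"
proof -
  interpret comm_group G by fact
  let ?g = "\<lambda>i. k (unit_vector n i)"
  have k: "k \<in> hom (Zn n) G" "k \<in> epi (Zn n) G" "inj_on k (carrier (Zn n))"
    using assms(2) by (auto simp: iso_iff_mon_epi mon_def)
  have "inj_on ?g {..<n}"
  proof (rule inj_onI)
    fix i j
    assume ij: "i \<in> {..<n}" "j \<in> {..<n}" "?g i = ?g j"
    then have "unit_vector n i = unit_vector n j"
      using inj_onD[OF k(3)] unit_vector_carrier by blast
    from fun_cong[OF this, of i] ij(1) show "i = j"
      by (simp add: unit_vector_def split: if_splits)
  qed
  moreover have "?g ` {..<n} \<subseteq> carrier G"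
    using hom_in_carrier[OF k(1) unit_vector_carrier] by auto
  moreover have "{x \<in> carrier (Zn n). \<one> \<preceq> (\<Otimes>i\<in>{..<n}. ?g i [^] x i)} = {x \<in> carrier (Zn n). \<one> \<preceq> k x}"
    using hom_Zn_eq_finprod[OF k(1)] by auto
  ultimately show ?thesis
    unfolding finitely_presented_def
    using fg generate_image_unit_vectors[OF k(2)] by (intro exI[of _ n] exI[of _ ?g]) simp
qed

section \<open>Groups ordered by a submonoid\<close>

lemma ordered_by_simps [simp]:
  "carrier (ordered_by G P) = carrier G"
  "monoid.mult (ordered_by G P) = monoid.mult G"
  "\<one>\<^bsub>ordered_by G P\<^esub> = \<one>\<^bsub>G\<^esub>"
  "leq (ordered_by G P) x y \<longleftrightarrow> y \<otimes>\<^bsub>G\<^esub> inv\<^bsub>G\<^esub> x \<in> P"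
  by (simp_all add: ordered_by_def)

lemma iso_ordered_by [simp]:
  "iso (ordered_by G P) H = iso G H" "iso H (ordered_by G P) = iso H G"
  by (simp_all add: iso_def hom_def)

lemma comm_group_ordered_by:
  assumes "comm_group G"
  shows "comm_group (ordered_by G P)"
proof -
  interpret comm_group G by fact
  show ?thesis
    by (rule comm_groupI) (auto simp: m_ac intro: l_inv_ex)
qed

text \<open>Reflexivity is \<open>\<one> \<in> P\<close>, transitivity is closure of
  \<open>P\<close>, antisymmetry is pointedness, and translation leaves differences
  unchanged.\<close>

lemma po_comm_group_ordered_by:
  fixes G (structure)
  assumes "comm_group G" "submonoid P G" and pointed: "\<And>x. \<lbrakk>x \<in> P; inv\<^bsub>G\<^esub> x \<in> P\<rbrakk> \<Longrightarrow> x = \<one>\<^bsub>G\<^esub>"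
  shows "po_comm_group (ordered_by G P)"
proof -
  interpret comm_group G by fact
  interpret P: submonoid P G by fact
  show ?thesis
  proof (rule po_comm_group.intro[OF comm_group_ordered_by[OF assms(1)]], unfold_locales)
    show "reflp_on (carrier (ordered_by G P)) (leq (ordered_by G P))"
      by (auto simp: reflp_on_def)
    show "antisymp_on (carrier (ordered_by G P)) (leq (ordered_by G P))"
    proof (rule antisymp_onI)
      fix x y
      assume xy: "x \<in> carrier (ordered_by G P)" "y \<in> carrier (ordered_by G P)"
        "leq (ordered_by G P) x y" "leq (ordered_by G P) y x"
      then have "inv (y \<otimes> inv x) = x \<otimes> inv y"
        by (simp add: inv_mult_group)
      with xy have "y \<otimes> inv x = \<one>"
        by (intro pointed) simp_all
      with xy show "x = y"
        by (metis ordered_by_simps(1) inv_closed inv_equality inv_inv)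
    qed
    show "transp_on (carrier (ordered_by G P)) (leq (ordered_by G P))"
    proof (rule transp_onI)
      fix x y z
      assume xyz: "x \<in> carrier (ordered_by G P)" "y \<in> carrier (ordered_by G P)" "z \<in> carrier (ordered_by G P)"
        "leq (ordered_by G P) x y" "leq (ordered_by G P) y z"
      then have "z \<otimes> inv x = (z \<otimes> inv y) \<otimes> (y \<otimes> inv x)"
        by (simp add: m_assoc) (simp add: m_assoc[symmetric])
      with xyz show "leq (ordered_by G P) x z"
        by simp
    qed
    show "leq (ordered_by G P) (x \<otimes>\<^bsub>ordered_by G P\<^esub> z) (y \<otimes>\<^bsub>ordered_by G P\<^esub> z)"
      if "x \<in> carrier (ordered_by G P)" "y \<in> carrier (ordered_by G P)" "z \<in> carrier (ordered_by G P)"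
        "leq (ordered_by G P) x y" for x y z
    proof -
      have "(y \<otimes> z) \<otimes> inv (x \<otimes> z) = y \<otimes> inv x"
        using that by (simp add: inv_mult_group m_assoc) (simp add: m_assoc[symmetric])
      with that show ?thesis by simp
    qed
  qed
qed

section \<open>Positive cones and the two directions of the equivalence\<close>

context po_comm_group
begin

lemma leq_iff_one_leq:
  assumes "x \<in> carrier G" "y \<in> carrier G"
  shows "x \<preceq> y \<longleftrightarrow> \<one> \<preceq> y \<otimes> inv x"
proof
  assume "x \<preceq> y"
  with assms leq_mult_right[of x y "inv x"] show "\<one> \<preceq> y \<otimes> inv x"
    by simp
next
  assume "\<one> \<preceq> y \<otimes> inv x"
  with assms leq_mult_right[of \<one> "y \<otimes> inv x" x] show "x \<preceq> y"
    by (simp add: m_assoc)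
qed

lemma positive_cone_pointed:
  assumes "x \<in> carrier G" "y \<in> carrier G" "\<one> \<preceq> x" "\<one> \<preceq> y" "x \<otimes> y = \<one>"
  shows "x = \<one>"
proof -
  \<comment> \<open>Translating \<open>\<one> \<preceq> y\<close> by \<open>x\<close> gives this,
    and antisymmetry finishes.\<close>
  have "x \<preceq> \<one>"
    using assms leq_mult_right[of \<one> y x] by (simp add: m_comm)
  with assms leq_antisym show ?thesis
    by (simp add: antisymp_on_def)
qed

lemma isomorphic_ordered_by_image:
  assumes \<eta>: "\<eta> \<in> iso G H" and "group H"
  shows "po_group_isomorphic G (ordered_by H (\<eta> ` {x \<in> carrier G. \<one> \<preceq> x}))"
proof -
  interpret \<eta>: group_hom G H \<eta>
    using assms is_group by (simp add: group_hom_def group_hom_axioms_def iso_def)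
  have inj: "inj_on \<eta> (carrier G)"
    using \<eta> by (simp add: iso_def bij_betw_def)
  have "x \<preceq> y \<longleftrightarrow> \<eta> y \<otimes>\<^bsub>H\<^esub> inv\<^bsub>H\<^esub> \<eta> x \<in> \<eta> ` {x \<in> carrier G. \<one> \<preceq> x}"
    if xy: "x \<in> carrier G" "y \<in> carrier G" for x y
  proof -
    have "\<eta> y \<otimes>\<^bsub>H\<^esub> inv\<^bsub>H\<^esub> \<eta> x = \<eta> (y \<otimes> inv x)"
      using xy by simp
    moreover have "y \<otimes> inv x \<in> carrier G"
      using xy by simp
    ultimately show ?thesis
      using leq_iff_one_leq[OF xy] inj by (auto dest: inj_onD)
  qed
  with \<eta> show ?thesis
    by (auto simp: po_group_isomorphic_def po_group_iso_def)
qed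

text \<open>For the inverse \<open>k\<close> of the isomorphism, the vectors that \<open>k\<close>
  sends to positive elements are exactly those in \<open>P\<close>; torsion-freeness is pulled back
  from Z^n.\<close>

lemma isomorphic_ordered_by_Zn_imp:
  assumes "fg_submonoid P (Zn n)" "po_group_isomorphic G (ordered_by (Zn n) P)"
  shows "finitely_presented G" "torsion_free G"
proof -
  obtain \<eta> where \<eta>: "\<eta> \<in> iso G (Zn n)"
    and leq: "\<And>x y. \<lbrakk>x \<in> carrier G; y \<in> carrier G\<rbrakk> \<Longrightarrow> x \<preceq> y \<longleftrightarrow> \<eta> y \<otimes>\<^bsub>Zn n\<^esub> inv\<^bsub>Zn n\<^esub> \<eta> x \<in> P"
    using assms(2) by (auto simp: po_group_isomorphic_def po_group_iso_def)
  show "torsion_free G"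
    using torsion_free_Zn \<eta> is_group group_Zn
    by (intro torsion_free_mon[of "Zn n" \<eta> G]) (simp_all add: iso_iff_mon_epi)
  interpret Zn: group "Zn n"
    by (rule group_Zn)
  define k where "k = inv_into (carrier G) \<eta>"
  have k: "k \<in> iso (Zn n) G"
    unfolding k_def using \<eta> by (rule iso_set_sym)
  have \<eta>k: "\<eta> (k x) = x" "k x \<in> carrier G" if "x \<in> carrier (Zn n)" for x
    using \<eta> that by (auto simp: k_def iso_def bij_betw_def intro: f_inv_into_f inv_into_into)
  have \<eta>1: "\<eta> \<one> = \<one>\<^bsub>Zn n\<^esub>"
    using \<eta> is_group group_Zn by (intro hom_one) (auto simp: iso_def)
  have "\<one> \<preceq> k x \<longleftrightarrow> x \<in> P" if "x \<in> carrier (Zn n)" for x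
    using leq[OF one_closed \<eta>k(2)[OF that]] that by (simp add: \<eta>k \<eta>1)
  moreover have "P \<subseteq> carrier (Zn n)"
    using assms(1) by (simp add: fg_submonoid_def submonoid_def)
  ultimately have "{x \<in> carrier (Zn n). \<one> \<preceq> k x} = P"
    by auto
  with assms(1) k show "finitely_presented G"
    by (intro finitely_presentedI[where k = k]) (auto intro: comm_group_axioms)
qed

lemma finitely_presented_torsion_free_imp_isomorphic:
  assumes "finitely_presented G" "torsion_free G"
  shows "\<exists>n P. fg_submonoid P (Zn n) \<and> P \<subseteq> nonneg_vectors n \<and>
    po_group_isomorphic G (ordered_by (Zn n) P)"
proof -
  define C where "C = {x \<in> carrier G. \<one> \<preceq> x}"
  obtain m and g :: "nat \<Rightarrow> 'a" where g: "g ` {..<m} \<subseteq> carrier G" "generate G (g ` {..<m}) = carrier G"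
    and fg: "fg_submonoid {x \<in> carrier (Zn m). \<one> \<preceq> (\<Otimes>i\<in>{..<m}. g i [^] x i)} (Zn m)"
    using assms(1) by (auto simp: finitely_presented_def)
  define f where "f = (\<lambda>x :: nat \<Rightarrow> int. \<Otimes>i\<in>{..<m}. g i [^] x i)"
  have f: "f \<in> epi (Zn m) G"
    unfolding f_def using g by (rule epi_Zn_of_generators)
  interpret f: group_hom "Zn m" G f
    using f group_Zn is_group by (simp add: group_hom_def group_hom_axioms_def epi_def)
  \<comment> \<open>Surjectivity of \<open>f\<close> gives the whole positive cone, which is thus
    the image of a finitely generated submonoid.\<close>
  have "f ` {x \<in> carrier (Zn m). \<one> \<preceq> f x} = C"
    using f by (auto simp: C_def epi_def)
  with fg have "fg_submonoid C G"
    using f.fg_submonoid_image[of "{x \<in> carrier (Zn m). \<one> \<preceq> f x}"] by (simp add: f_def)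
  obtain n \<theta>' where "\<theta>' \<in> iso (Zn n) G"
    using torsion_free_epi_Zn_imp_iso[OF assms(2) f] by blast
  then obtain \<theta> where \<theta>: "\<theta> \<in> iso G (Zn n)"
    using group.iso_set_sym[OF group_Zn] by blast
  interpret \<theta>: group_hom G "Zn n" \<theta>
    using \<theta> group_Zn is_group by (simp add: group_hom_def group_hom_axioms_def iso_def)
  have inj: "inj_on \<theta> (carrier G)"
    using \<theta> by (simp add: iso_def bij_betw_def)
  \<comment> \<open>Pointedness is checked in \<open>G\<close>: injectivity of
    \<open>\<theta>\<close> pulls a pair of inverses back to the positive cone.\<close>
  have "\<exists>h \<in> iso (Zn n) (Zn n). h ` (\<theta> ` C) \<subseteq> nonneg_vectors n"
  proof (rule pointed_fg_submonoid_into_nonneg_vectors)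
    show "fg_submonoid (\<theta> ` C) (Zn n)"
      using \<open>fg_submonoid C G\<close> by (rule \<theta>.fg_submonoid_image)
    fix x y
    assume "x \<in> \<theta> ` C" "y \<in> \<theta> ` C" and xy: "x \<otimes>\<^bsub>Zn n\<^esub> y = \<one>\<^bsub>Zn n\<^esub>"
    then obtain a b where ab: "a \<in> C" "b \<in> C" "x = \<theta> a" "y = \<theta> b"
      by blast
    with xy have "\<theta> (a \<otimes> b) = \<theta> \<one>"
      by (simp add: C_def)
    with ab have "a \<otimes> b = \<one>"
      using inj_onD[OF inj] by (simp add: C_def)
    with ab have "a = \<one>"
      using positive_cone_pointed[of a b] by (simp add: C_def)
    with ab show "x = \<one>\<^bsub>Zn n\<^esub>"
      by simp
  qed
  then obtain h where h: "h \<in> iso (Zn n) (Zn n)" "(h \<circ> \<theta>) ` C \<subseteq> nonneg_vectors n"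
    by (auto simp: image_comp)
  have iso: "h \<circ> \<theta> \<in> iso G (Zn n)"
    using \<theta> h(1) by (rule iso_set_trans)
  interpret h\<theta>: group_hom G "Zn n" "h \<circ> \<theta>"
    using iso group_Zn is_group by (simp add: group_hom_def group_hom_axioms_def iso_def)
  have "fg_submonoid ((h \<circ> \<theta>) ` C) (Zn n)"
    using \<open>fg_submonoid C G\<close> by (rule h\<theta>.fg_submonoid_image)
  with h(2) isomorphic_ordered_by_image[OF iso group_Zn] show ?thesis
    unfolding C_def by blast
qed

end

lemma ordered_by_Zn:
  assumes P: "fg_submonoid P (Zn n)" "P \<subseteq> nonneg_vectors n"
  shows "po_comm_group (ordered_by (Zn n) P)" "finitely_presented (ordered_by (Zn n) P)"
    "torsion_free (ordered_by (Zn n) P)"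
proof -
  have sub: "submonoid P (Zn n)"
    using P(1) by (simp add: fg_submonoid_def)
  have pointed: "x = \<one>\<^bsub>Zn n\<^esub>" if "x \<in> P" "inv\<^bsub>Zn n\<^esub> x \<in> P" for x
  proof -
    have x: "x \<in> carrier (Zn n)"
      using sub that(1) by (rule submonoid.mem_carrier)
    \<comment> \<open>A vector and its negative both lie in the nonnegative orthant only if the
      vector is zero.\<close>
    have "0 \<le> x i" "0 \<le> - x i" if "i < n" for i
      using \<open>x \<in> P\<close> \<open>inv\<^bsub>Zn n\<^esub> x \<in> P\<close> P(2) that x by (auto simp: nonneg_vectors_def inv_Zn PiE_iff subset_iff)
    with x show ?thesis
      by (intro Zn_eqI[of _ n]) (force simp: one_Zn carrier_Zn)+
  qed
  show po: "po_comm_group (ordered_by (Zn n) P)"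
    using comm_group_Zn sub pointed by (rule po_comm_group_ordered_by)
  \<comment> \<open>The identity isomorphism makes the previous direction applicable to the model
    itself.\<close>
  have "po_group_isomorphic (ordered_by (Zn n) P) (ordered_by (Zn n) P)"
    unfolding po_group_isomorphic_def po_group_iso_def using iso_set_refl[of "Zn n"] by auto
  with P(1) show "finitely_presented (ordered_by (Zn n) P)" "torsion_free (ordered_by (Zn n) P)"
    using po_comm_group.isomorphic_ordered_by_Zn_imp[OF po] by blast+
qed

theorem theorem5p2:
  fixes G :: "('a, 'c) ordered_monoid_scheme"
  shows "(po_comm_group G \<longrightarrow>
            (finitely_presented G \<and> torsion_free G \<longleftrightarrow>
             (\<exists>n P. fg_submonoid P (Zn n) \<and> P \<subseteq> nonneg_vectors n \<and>
                    po_group_isomorphic G (ordered_by (Zn n) P)))) \<and>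
         (\<forall>n P. fg_submonoid P (Zn n) \<and> P \<subseteq> nonneg_vectors n \<longrightarrow>
            po_comm_group (ordered_by (Zn n) P) \<and>
            finitely_presented (ordered_by (Zn n) P) \<and>
            torsion_free (ordered_by (Zn n) P))"
  using po_comm_group.finitely_presented_torsion_free_imp_isomorphic
    po_comm_group.isomorphic_ordered_by_Zn_imp ordered_by_Zn
  by blast

end
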